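(* Let $a\ge 1$ and $k\ge 1$ be integers and let $S$ be a finite sequence of letters from the alphabet $[a]=\{1,\dots,a\}$. Then $S$ is $k$-omni if and only if there exists a pairwise-disjoint collection $P$ of $1$-omni substrings of $S$ such that $|P|\ge k$.
   Context: A finite sequence (string) $S=(s_1,\dots,s_n)$ over $[a]$ is called $k$-omni if every one of the $a^k$ words of length $k$ over $[a]$ occurs in $S$ as a (not necessarily contiguous) subsequence. A substring of $S$ is a contiguous block $(s_i,s_{i+1},\dots,s_j)$; substrings are regarded as disjoint when the index intervals they occupy are disjoint. A substring is $1$-omni exactly when it contains every letter of $[a]$ at least once (a "completed set of coupons"). *)

theory Defs
  imports Main "HOL-Library.Sublist"
begin

definition omni :: "nat \<Rightarrow> nat \<Rightarrow> nat list \<Rightarrow> bool" where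
  "omni a k S \<longleftrightarrow> (\<forall>w. length w = k \<and> set w \<subseteq> {1..a} \<longrightarrow> subseq w S)"

text \<open>
  A substring is represented by its occurrence, i.e. by the pair \<open>(i, j)\<close> of its first and last
  (0-based, inclusive) position, and not by the list of its letters: equal blocks at different
  positions are different substrings, and disjointness concerns positions.
\<close>

definition substrings :: "'a list \<Rightarrow> (nat \<times> nat) set" where
  "substrings S = {(i, j). i \<le> j \<and> j < length S}"

definition letters :: "'a list \<Rightarrow> nat \<times> nat \<Rightarrow> 'a list" where
  "letters S = (\<lambda>(i, j). map (\<lambda>m. S ! m) [i..<Suc j])"

definition positions :: "nat \<times> nat \<Rightarrow> nat set" where
  "positions = (\<lambda>(i, j). {i..j})"

end

theory Submission
  imports Defs
begin

text \<open>
  Any \<open>k\<close> disjoint 1-omni blocks, read from left to right, provide the letters of a word of length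
  \<open>k\<close> one after the other. Conversely, cut off the shortest prefix of \<open>S\<close> that contains all letters:
  its last letter \<open>x\<close> occurs in it only once, so in the words \<open>x # w\<close> the tail \<open>w\<close> has to embed into
  the remainder of \<open>S\<close>, which is therefore \<open>(k - 1)\<close>-omni.
\<close>

lemma omni_1_iff: "omni a 1 S \<longleftrightarrow> {1..a} \<subseteq> set S"
  by (auto simp: omni_def length_Suc_conv subseq_singleton_left)

lemma finite_substrings: "finite (substrings S)"
  by (rule finite_subset[of _ "{..<length S} \<times> {..<length S}"]) (auto simp: substrings_def)

lemma letters_eq_take_drop:
  assumes "j < length S"
  shows "letters S (i, j) = take (Suc j - i) (drop i S)"
  using assms by (intro nth_equalityI) (auto simp: letters_def simp del: upt_Suc)

lemma disjnt_positions_iff: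
  assumes "i \<le> j" "i' \<le> j'"
  shows "disjnt (positions (i, j)) (positions (i', j')) \<longleftrightarrow> j < i' \<or> j' < i"
  using assms by (auto simp: positions_def disjnt_def)

text \<open>Since \<open>us\<close> lacks \<open>x\<close>, the leading \<open>x\<close> of the word
  cannot be matched before the \<open>x\<close> shown after \<open>us\<close>; all later letters
  then have to be matched inside \<open>vs\<close>.\<close>

lemma subseq_Cons_append_notin:
  assumes "subseq (x # w) (us @ x # vs)" and "x \<notin> set us"
  shows "subseq w vs"
  using assms by (induction us) (auto split: if_splits)

lemma omni_Suc_split:
  assumes "omni a (Suc k) S" and "a \<ge> 1"
  obtains m where "0 < m" "m \<le> length S" "{1..a} \<subseteq> set (take m S)" "omni a k (drop m S)"
proof -
  define m where "m = (LEAST m. {1..a} \<subseteq> set (take m S))"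
  have "{1..a} \<subseteq> set S"
  proof
    fix x assume x: "x \<in> {1..a}"
    \<comment> \<open>Constant words already force every letter to occur in \<open>S\<close>, so the
      set whose least element is \<open>m\<close> is nonempty.\<close>
    then have "subseq (replicate (Suc k) x) S"
      using assms(1) unfolding omni_def by (auto simp del: replicate_Suc)
    then show "x \<in> set S"
      by (auto dest: list_emb_set)
  qed
  then have all: "{1..a} \<subseteq> set (take (length S) S)"
    by simp
  have m: "{1..a} \<subseteq> set (take m S)"
    unfolding m_def by (rule LeastI[of _ "length S"]) (rule all)
  have le: "m \<le> length S"
    unfolding m_def by (rule Least_le) (rule all)
  \<comment> \<open>With a nonempty alphabet the empty prefix is not complete, so
    \<open>take l S\<close> below is exactly one letter shorter than
    \<open>take m S\<close>.\<close>
  have pos: "0 < m"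
    using m \<open>a \<ge> 1\<close> by (cases m) auto
  then obtain l where l: "m = Suc l"
    by (cases m) auto
  have "\<not> {1..a} \<subseteq> set (take l S)"
    using not_less_Least[of l "\<lambda>m. {1..a} \<subseteq> set (take m S)"] l unfolding m_def by simp
  then obtain x where x: "x \<in> {1..a}" "x \<notin> set (take l S)"
    by blast
  have S_split: "take m S = take l S @ [S ! l]" "S = take l S @ S ! l # drop m S"
    using le l by (simp_all add: take_Suc_conv_app_nth id_take_nth_drop[symmetric])
  have x_eq: "S ! l = x"
    using x m S_split(1) by auto
  have "omni a k (drop m S)"
    unfolding omni_def
  proof (intro allI impI)
    fix w assume "length w = k \<and> set w \<subseteq> {1..a}"
    then have "subseq (x # w) S"
      using assms(1) x(1) by (simp add: omni_def)
    then have "subseq (x # w) (take l S @ x # drop m S)"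
      using S_split(2) x_eq by metis
    then show "subseq w (drop m S)"
      using x(2) by (rule subseq_Cons_append_notin)
  qed
  with pos le m show thesis
    by (rule that)
qed

text \<open>The offset \<open>n\<close> keeps all positions relative to the full \<open>S\<close>,
  so blocks found in a remainder need no shifting. The bound on \<open>fst p\<close> keeps them to
  the right of the block cut off before.\<close>

lemma blocks_of_omni:
  assumes "omni a k (drop n S)" and "a \<ge> 1"
  shows "\<exists>P. P \<subseteq> substrings S \<and> (\<forall>p\<in>P. n \<le> fst p \<and> omni a 1 (letters S p)) \<and>
    pairwise (\<lambda>p q. disjnt (positions p) (positions q)) P \<and> card P = k"
  using assms(1)
proof (induction k arbitrary: n)
  case 0
  show ?case by (rule exI[of _ "{}"]) simp
next
  case (Suc k)
  obtain m where m: "0 < m" "m \<le> length (drop n S)" "{1..a} \<subseteq> set (take m (drop n S))"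
      "omni a k (drop m (drop n S))"
    using Suc.prems \<open>a \<ge> 1\<close> by (rule omni_Suc_split)
  from m(4) have "omni a k (drop (n + m) S)"
    by (simp add: add.commute)
  from Suc.IH[OF this] obtain P where P: "P \<subseteq> substrings S"
      "\<forall>p\<in>P. n + m \<le> fst p \<and> omni a 1 (letters S p)"
      "pairwise (\<lambda>p q. disjnt (positions p) (positions q)) P" "card P = k"
    by blast
  \<comment> \<open>The block of length \<open>m\<close> starting at \<open>n\<close>; end positions
    are inclusive, and \<open>0 < m\<close> keeps the interval nonempty.\<close>
  let ?p = "(n, n + m - 1)"
  have "letters S ?p = take m (drop n S)"
    using m(1,2) by (subst letters_eq_take_drop) auto
  then have "omni a 1 (letters S ?p)"
    using m(3) by (simp only: omni_1_iff)
  moreover have "?p \<in> substrings S"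
    using m(1,2) by (auto simp: substrings_def)
  moreover have "finite P"
    using P(1) finite_substrings by (rule finite_subset)
  moreover have "?p \<notin> P"
    using P(2) m(1) by fastforce
  moreover have "disjnt (positions ?p) (positions q)" if "q \<in> P" for q
    using P(2) that m(1) by (cases q) (fastforce simp: positions_def disjnt_def)
  ultimately show ?case
    using P by (intro exI[of _ "insert ?p P"]) (auto simp: pairwise_insert disjnt_sym)
qed

text \<open>Induction on \<open>w\<close>: the block that ends first supplies the head of
  \<open>w\<close>, and the remaining blocks supply the tail from the offset just after it.\<close>

lemma subseq_of_blocks:
  assumes "P \<subseteq> substrings S" and "\<forall>p\<in>P. n \<le> fst p \<and> omni a 1 (letters S p)"
    and "pairwise (\<lambda>p q. disjnt (positions p) (positions q)) P"
    and "length w \<le> card P" and "set w \<subseteq> {1..a}"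
  shows "subseq w (drop n S)"
  using assms
proof (induction w arbitrary: n P)
  case Nil
  show ?case by simp
next
  case (Cons x w)
  have "P \<noteq> {}"
    using Cons.prems(4) by auto
  then obtain p where "p \<in> P" and min: "\<And>q. q \<in> P \<Longrightarrow> snd p \<le> snd q"
    using exists_least_iff[of "\<lambda>j. \<exists>p\<in>P. snd p = j"] by (metis ex_in_conv not_le_imp_less)
  obtain i j where p: "p = (i, j)"
    by (cases p)
  have ij: "i \<le> j" "j < length S" "n \<le> i" "omni a 1 (letters S (i, j))"
    using \<open>p \<in> P\<close> Cons.prems(1,2) p by (auto simp: substrings_def)
  \<comment> \<open>Of the two ways to be disjoint, \<open>q\<close> ending before \<open>p\<close>
    starts is excluded because \<open>p\<close> has the smallest end.\<close>
  have later: "j < fst q" if "q \<in> P - {p}" for q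
  proof -
    obtain i' j' where q: "q = (i', j')"
      by (cases q)
    then have "i' \<le> j'" "j \<le> j'"
      using that Cons.prems(1) min[of q] p by (auto simp: substrings_def)
    moreover have "disjnt (positions (i, j)) (positions (i', j'))"
      using Cons.prems(3) that \<open>p \<in> P\<close> p q by (auto simp: pairwise_def)
    ultimately show ?thesis
      using ij(1) q by (auto simp: disjnt_positions_iff)
  qed
  have "length w \<le> card (P - {p})"
    using Cons.prems(4) \<open>p \<in> P\<close> by (simp add: card_Diff_singleton)
  moreover have "pairwise (\<lambda>p q. disjnt (positions p) (positions q)) (P - {p})"
    using Cons.prems(3) by (rule pairwise_subset) auto
  ultimately have w: "subseq w (drop (Suc j) S)"
    using Cons.prems(1,2,5) later by (intro Cons.IH[of "P - {p}"]) (auto simp: Suc_le_eq)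
  \<comment> \<open>The block lies between positions \<open>n\<close> and \<open>j\<close>, so
    \<open>x\<close> embeds there and does not interfere with \<open>w\<close>, which embeds from
    \<open>Suc j\<close> on.\<close>
  have "x \<in> set (take (Suc j - i) (drop i S))"
    using ij Cons.prems(5) letters_eq_take_drop[of j S i] unfolding omni_1_iff by auto
  also have "\<dots> = set (drop i (take (Suc j) S))"
    by (simp add: drop_take)
  also have "\<dots> \<subseteq> set (drop n (take (Suc j) S))"
    using ij(3) by (rule set_drop_subset_set_drop)
  finally have "subseq [x] (drop n (take (Suc j) S))"
    by (simp add: subseq_singleton_left)
  from list_emb_append_mono[OF this w]
  have "subseq (x # w) (drop n (take (Suc j) S) @ drop (Suc j) S)"
    by simp
  \<comment> \<open>As \<open>n\<close> is at most \<open>j\<close>, dropping \<open>n\<close>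
    letters does not reach the second part.\<close>
  also have "drop n (take (Suc j) S) @ drop (Suc j) S = drop n (take (Suc j) S @ drop (Suc j) S)"
    using ij by (simp only: drop_append) simp
  also have "\<dots> = drop n S"
    by simp
  finally show ?case .
qed

theorem lemma3p1:
  fixes a k :: nat and S :: "nat list"
  assumes "a \<ge> 1" and "k \<ge> 1" and "set S \<subseteq> {1..a}"
  shows "omni a k S \<longleftrightarrow>
    (\<exists>P. P \<subseteq> substrings S \<and>
         (\<forall>p\<in>P. omni a 1 (letters S p)) \<and>
         pairwise (\<lambda>p q. disjnt (positions p) (positions q)) P \<and>
         card P \<ge> k)"
  (is "_ \<longleftrightarrow> ?R")
proof
  assume "omni a k S"
  then show ?R
    using blocks_of_omni[of a k 0 S] \<open>a \<ge> 1\<close> by auto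
next
  assume ?R
  then show "omni a k S"
    using subseq_of_blocks[of _ S 0 a] by (auto simp: omni_def[of a k])
qed

end
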